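(* Let $p$ be an odd prime, let $m\ge 2$ be an even integer, let $q=p^m$, and let $D=\{x\in \mathrm{GF}(q)^*: \mathrm{Tr}(x^2)=0\}=\{d_1,\ldots,d_n\}$. Put $\varepsilon=(-1)^{\left(\frac{p-1}{2}\right)^2\frac{m}{2}}$. Then the code $$\mathcal{C}_D=\{(\mathrm{Tr}(xd_1),\mathrm{Tr}(xd_2),\ldots,\mathrm{Tr}(xd_n)): x\in \mathrm{GF}(q)\}$$ over $\mathrm{GF}(p)$ has length $n=p^{m-1}-\varepsilon(p-1)p^{\frac{m-2}{2}}-1$ and dimension $m$, and its weight distribution is - $A_0=1$; - $A_w=p^{m-1}-\varepsilon(p-1)p^{\frac{m-2}{2}}-1$ for $w=(p-1)p^{m-2}$; - $A_w=(p-1)\left(p^{m-1}+\varepsilon p^{\frac{m-2}{2}}\right)$ for $w=(p-1)\left(p^{m-2}-\varepsilon p^{\frac{m-2}{2}}\right)$; and $A_w=0$ for all other weights $w$.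
   Context: $\mathrm{GF}(q)$ is the finite field with $q$ elements, $\mathrm{GF}(q)^*$ its multiplicative group, and $\mathrm{Tr}$ is the trace function from $\mathrm{GF}(q)$ onto $\mathrm{GF}(p)$. The elements $d_1,\ldots,d_n$ of $D$ are distinct and listed in any fixed order. A linear code of length $n$ and dimension $k$ over $\mathrm{GF}(p)$ is a $k$-dimensional subspace of $\mathrm{GF}(p)^n$; $A_w$ denotes the number of codewords of Hamming weight $w$ in the code.
   Formalization: The dimension m and the count for w=(p-1)(p^{m-2}-εp^{(m-2)/2}) are claimed only when n>0. For m=2 and p≡1 mod 4, D is empty, the code has dimension 0, and that weight is 0 with claimed count p²-1, contradicting A_0=1; so the statement is false there. *)

theory Defs
  imports
    "Berlekamp_Zassenhaus.Finite_Field"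
    "Jordan_Normal_Form.VS_Connect"
begin

text \<open>The field GF(p) is \<open>'p mod_ring\<close> with \<open>CARD('p) = p\<close> prime; GF(q) is any finite field type
  \<open>'a\<close> with \<open>p ^ m\<close> elements. The inclusion of GF(p) into GF(q) is the unique ring homomorphism;
  it sends a residue class to the image of any of its integer representatives.\<close>

definition gf_embed :: "'p::prime_card mod_ring \<Rightarrow> 'a::{field,finite}" where
  "gf_embed a = of_int (to_int_mod_ring a)"

text \<open>The trace \<open>x + x^p + \<dots> + x^(p^(m-1))\<close>, read as an element of GF(p). The description is
  proper whenever \<open>CARD('a) = CARD('p) ^ m\<close>.\<close>

definition gf_trace :: "nat \<Rightarrow> 'a::{field,finite} \<Rightarrow> 'p::prime_card mod_ring" where
  "gf_trace m x = (THE a. gf_embed a = (\<Sum>i<m. x ^ (CARD('p) ^ i)))"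

definition trace_code :: "nat \<Rightarrow> 'a::{field,finite} list \<Rightarrow> 'p::prime_card mod_ring vec set" where
  "trace_code m ds = range (\<lambda>x. vec_of_list (map (\<lambda>d. gf_trace m (x * d)) ds))"

definition hamming_weight :: "'k::zero vec \<Rightarrow> nat" where
  "hamming_weight v = card {i. i < dim_vec v \<and> v $ i \<noteq> 0}"

definition weight_count :: "'k::zero vec set \<Rightarrow> nat \<Rightarrow> nat" where
  "weight_count C w = card {c \<in> C. hamming_weight c = w}"

definition linear_code :: "nat \<Rightarrow> 'k::field vec set \<Rightarrow> bool" where
  "linear_code n C \<longleftrightarrow> VectorSpace.subspace class_ring C (module_vec TYPE('k) n)"

definition code_dim :: "nat \<Rightarrow> 'k::field vec set \<Rightarrow> nat" where
  "code_dim n C = vectorspace.dim class_ring ((module_vec TYPE('k) n)\<lparr>carrier := C\<rparr>)"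

end

theory Submission
  imports Defs
begin

text \<open>
  Let \<open>Q x = Tr (x\<^sup>2)\<close> and let \<open>N t\<close> be the number of solutions of \<open>Q x = t\<close>. Since \<open>m\<close> is even,
  every element of GF(p) is a square in GF(q), so scaling shows that \<open>N t = N 1\<close> for \<open>t \<noteq> 0\<close>. No
  character sums are needed to find the deviation \<open>\<delta> = N 1 - p ^ (m - 1)\<close>: the solutions of
  \<open>Q x = Q y\<close> correspond to those of \<open>Tr (u * v) = 0\<close> via \<open>u = x + y\<close>, \<open>v = x - y\<close>, and counting both
  gives \<open>\<delta>\<^sup>2 = p ^ (m - 2)\<close>. The sign of \<open>\<delta>\<close> is decided modulo 4: \<open>N 1 = 2 * A\<close>, where \<open>A\<close> counts the
  squares of trace 1, and \<open>A\<close> is odd. Indeed, write \<open>m = 2 ^ a * r\<close> with \<open>r\<close> odd. The map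
  \<open>y \<mapsto> y ^ (p ^ r)\<close> generates a 2-group, so \<open>A\<close> has the parity of the number of fixed squares of
  trace 1; but every fixed point is a square, and so this is also the parity of the number
  \<open>p ^ (m - 1)\<close> of all elements of trace 1.

  For \<open>b \<noteq> 0\<close>, counting the pairs \<open>(l, v)\<close> with \<open>l \<in> GF(p)\<^sup>*\<close> and \<open>Q (b + l * v) = Q b\<close>, first
  by \<open>l\<close> and then by \<open>v\<close>, determines the number of zeros of \<open>Q\<close> on the hyperplane
  \<open>Tr (b * x) = 0\<close>, and hence the weight of the codeword of \<open>b\<close>.
\<close>

section \<open>Squares in finite fields\<close>

text \<open>Multiplication by a nonzero \<open>x\<close> permutes the nonzero elements, so it
  preserves their product, which can then be cancelled.\<close>

lemma finite_field_power_card: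
  fixes x :: "'a::{field,finite}"
  shows "x ^ CARD('a) = x"
proof (cases "x = 0")
  case False
  have "x * (\<Prod>y\<in>UNIV-{0}. x * y) = x * x ^ (CARD('a) - 1) * \<Prod>(UNIV-{0})"
    by (simp add: prod.distrib mult_ac)
  also have "x * x ^ (CARD('a) - 1) = x ^ CARD('a)"
    by (simp flip: power_Suc)
  also have "(\<Prod>y\<in>UNIV-{0}. x * y) = (\<Prod>y\<in>UNIV-{0}. y)"
    by (rule prod.reindex_bij_witness[of _ "\<lambda>y. y / x" "\<lambda>y. x * y"]) (use False in auto)
  finally show ?thesis by simp
qed simp

text \<open>Each fibre of squaring on \<open>X\<close> is a pair \<open>{c, - c}\<close>, whose
  members differ because \<open>2\<close> and \<open>c\<close> are nonzero.\<close>

lemma card_eq_twice_card_squares: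
  fixes X :: "'a::{field,finite} set"
  assumes two: "(2::'a) \<noteq> 0" and "0 \<notin> X" and "\<And>x. x \<in> X \<Longrightarrow> - x \<in> X"
  shows "card X = 2 * card ((\<lambda>x. x ^ 2) ` X)"
proof -
  have fin: "finite X" by simp
  have "card {x \<in> X. x ^ 2 = y} = 2" if "y \<in> (\<lambda>x. x ^ 2) ` X" for y
  proof -
    from that obtain c where c: "c \<in> X" "y = c ^ 2" by blast
    then have "{x \<in> X. x ^ 2 = y} = {c, - c}"
      using assms(3) by (auto simp: power2_eq_iff)
    moreover have "c \<noteq> - c"
    proof
      assume "c = - c"
      then have "2 * c = 0" by (metis add.right_inverse mult_2)
      then show False using two c assms(2) by auto
    qed
    ultimately show ?thesis by simp
  qed
  moreover have "card X = (\<Sum>y\<in>(\<lambda>x. x ^ 2) ` X. card {x \<in> X. x ^ 2 = y})"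
    using sum.image_gen[OF fin, of "\<lambda>_. 1::nat" "\<lambda>x. x ^ 2"] by simp
  ultimately show ?thesis by simp
qed

text \<open>Euler's criterion: the \<open>h\<close> nonzero squares are roots of
  \<open>X^h - 1\<close>, which has at most \<open>h\<close> roots, so every root is a
  square.\<close>

lemma euler_square:
  fixes y :: "'a::{field,finite}"
  assumes two: "(2::'a) \<noteq> 0" and "y ^ h = 1" and h: "2 * h = CARD('a) - 1"
  shows "\<exists>c. y = c ^ 2"
proof -
  define S where "S = (\<lambda>x::'a. x ^ 2) ` (UNIV - {0})"
  have "card (UNIV - {0::'a}) = 2 * card S"
    unfolding S_def by (rule card_eq_twice_card_squares[OF two]) auto
  moreover have "card (UNIV - {0::'a}) = CARD('a) - 1" by simp
  ultimately have cS: "card S = h" using h by linarith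
  have "CARD('a) \<ge> 2"
    using card_mono[of "UNIV::'a set" "{0,1}"] by simp
  then have hpos: "h > 0" using h by linarith
  define P where "P = monom (1::'a) h - 1"
  have "coeff P h = 1" using hpos by (simp add: P_def)
  then have P0: "P \<noteq> 0" by auto
  have "degree P \<le> h"
    unfolding P_def by (rule degree_diff_le) (auto simp: degree_monom_eq)
  with card_poly_roots_bound[OF P0] have le: "card {x. poly P x = 0} \<le> h" by linarith
  have "S \<subseteq> {x. poly P x = 0}"
  proof
    fix s assume "s \<in> S"
    then obtain x where x: "x \<noteq> 0" "s = x ^ 2" by (auto simp: S_def)
    have "x * x ^ (2 * h) = x"
      using finite_field_power_card[of x] \<open>CARD('a) \<ge> 2\<close> h by (simp flip: power_Suc)
    then have "s ^ h = 1" using x by (simp add: power_mult)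
    then show "s \<in> {x. poly P x = 0}" by (simp add: P_def poly_monom)
  qed
  then have "S = {x. poly P x = 0}"
    using cS le by (metis card_seteq finite)
  moreover have "y \<in> {x. poly P x = 0}" using assms(2) by (simp add: P_def poly_monom)
  ultimately show ?thesis by (auto simp: S_def)
qed

text \<open>A nonzero \<open>y\<close> has order dividing \<open>P - 1\<close>, and
  \<open>P - 1\<close> divides \<open>(P ^ (2 * k) - 1) / 2\<close>, since it divides
  \<open>P ^ k - 1\<close> while \<open>P ^ k + 1\<close> is even. This serves both for
  \<open>P = p\<close> and for a power of \<open>p\<close>.\<close>

lemma fixed_imp_square:
  fixes y :: "'a::{field,finite}"
  assumes two: "(2::'a) \<noteq> 0" and "odd P" and card: "CARD('a) = P ^ (2 * k)" and fixd: "y ^ P = y"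
  shows "\<exists>c. y = c ^ 2"
proof (cases "y = 0")
  case False
  have P1: "P \<ge> 1" using \<open>odd P\<close> by (cases P) auto
  have "y * y ^ (P - 1) = y" using fixd P1 by (simp flip: power_Suc)
  then have y1: "y ^ (P - 1) = 1" using False by simp
  have "[P ^ k = 1 ^ k] (mod (P - 1))"
    by (intro cong_pow) (use P1 in \<open>simp add: cong_altdef_nat\<close>)
  then have "(P - 1) dvd (P ^ k - 1)"
    using P1 by (simp add: cong_altdef_nat)
  then obtain j where j: "P ^ k - 1 = (P - 1) * j" by blast
  obtain l where l: "P ^ k + 1 = 2 * l" using \<open>odd P\<close> by (metis evenE even_plus_one_iff even_power)
  have "2 * ((P - 1) * (j * l)) = (P ^ k - 1) * (P ^ k + 1)" using j l by (simp add: mult_ac)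
  also have "\<dots> = P ^ (2 * k) - 1"
    by (simp add: algebra_simps power_mult power2_eq_square power_even_eq)
  finally have "2 * ((P - 1) * (j * l)) = CARD('a) - 1" using card by simp
  moreover have "y ^ ((P - 1) * (j * l)) = 1" using y1 by (simp add: power_mult)
  ultimately show ?thesis using euler_square[OF two] by blast
qed (intro exI[of _ 0], simp)

section \<open>Parity of fixed point sets\<close>

text \<open>The orbits \<open>{y, g y}\<close> have two elements each; the induction removes one
  orbit at a time.\<close>

lemma even_card_involution:
  assumes "finite Y" and "\<And>y. y \<in> Y \<Longrightarrow> g y \<in> Y" and "\<And>y. y \<in> Y \<Longrightarrow> g (g y) = y"
    and "\<And>y. y \<in> Y \<Longrightarrow> g y \<noteq> y"
  shows "even (card Y)"
  using assms
proof (induction "card Y" arbitrary: Y rule: less_induct)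
  case less
  show ?case
  proof (cases "Y = {}")
    case False
    then obtain y where y: "y \<in> Y" by blast
    let ?Z = "Y - {y, g y}"
    have sub: "{y, g y} \<subseteq> Y" "card {y, g y} = 2" using less.prems(2,4)[OF y] y by auto
    have c: "card Y = card ?Z + 2"
      using sub less.prems(1) by (metis card_Diff_subset card_mono finite_subset le_add_diff_inverse2)
    have "even (card ?Z)"
    proof (rule less.hyps)
      show "card ?Z < card Y" using c by simp
      show "finite ?Z" using less.prems by simp
      fix z assume z: "z \<in> ?Z"
      show "g z \<in> ?Z" using z y less.prems(2,3) by (metis Diff_iff insertCI insertE singletonD)
      show "g (g z) = z" "g z \<noteq> z" using z less.prems by auto
    qed
    then show ?thesis using c by simp
  qed simp
qed

text \<open>Induction on the exponent: \<open>g = f ^^ (2 ^ a)\<close> is an involution on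
  \<open>Y\<close>, so its non-fixed points are even in number, and on its fixed points
  \<open>f\<close> satisfies the hypothesis for \<open>a\<close>.\<close>

lemma parity_card_fixed_points:
  assumes "finite Y" and "\<And>y. y \<in> Y \<Longrightarrow> f y \<in> Y" and "\<And>y. y \<in> Y \<Longrightarrow> (f ^^ (2 ^ a)) y = y"
  shows "even (card Y) \<longleftrightarrow> even (card {y \<in> Y. f y = y})"
  using assms
proof (induction a arbitrary: Y)
  case 0
  then have "{y \<in> Y. f y = y} = Y" by auto
  then show ?case by simp
next
  case (Suc a)
  define g where "g = f ^^ (2 ^ a)"
  have closed: "(f ^^ k) y \<in> Y" if "y \<in> Y" for y k
    using that Suc.prems(2) by (induction k) auto
  have gg: "g (g y) = y" if "y \<in> Y" for y
    using Suc.prems(3)[OF that] by (simp add: g_def mult_2 funpow_add)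
  have comm: "g (f y) = f (g y)" for y
    by (simp add: g_def funpow_swap1)
  let ?F = "{y \<in> Y. g y = y}" and ?N = "{y \<in> Y. g y \<noteq> y}"
  have "even (card ?N)"
    by (rule even_card_involution[of _ g]) (use Suc.prems(1) closed gg in \<open>auto simp: g_def\<close>)
  moreover have "card Y = card ?F + card ?N"
    using Suc.prems(1) by (subst card_Un_disjoint[symmetric]) (auto intro: arg_cong[of _ _ card])
  moreover have "even (card ?F) \<longleftrightarrow> even (card {y \<in> ?F. f y = y})"
    by (rule Suc.IH) (use Suc.prems comm in \<open>auto simp: g_def\<close>)
  moreover have "{y \<in> ?F. f y = y} = {y \<in> Y. f y = y}"
  proof -
    have "g y = y" if "f y = y" for y
    proof -
      have "(f ^^ k) y = y" for k using that by (induction k) auto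
      then show ?thesis by (simp add: g_def)
    qed
    then show ?thesis by auto
  qed
  ultimately show ?case by simp
qed

section \<open>The trace\<close>

locale gf_extension =
  fixes TA :: "'a::{field,finite} itself" and TP :: "'p::prime_card itself" and p m :: nat
  assumes card_base: "CARD('p) = p" and card_ext: "CARD('a) = p ^ m" and m_pos: "m > 0"
begin

abbreviation emb :: "'p mod_ring \<Rightarrow> 'a" where "emb \<equiv> gf_embed"
abbreviation tr :: "'a \<Rightarrow> 'p mod_ring" where "tr \<equiv> gf_trace m"

lemma prime_p: "prime p"
  using prime_card[where 'a='p] by (simp add: card_base)

lemma p_gt_1: "p > 1"
  using prime_p by (simp add: prime_gt_Suc_0_nat)

text \<open>The characteristic is a prime divisor of \<open>p ^ m\<close>.\<close>

lemma char_ext: "CHAR('a) = p"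
proof -
  have "prime CHAR('a)"
    by (rule prime_CHAR_semidom) (simp add: finite_imp_CHAR_pos)
  moreover have "CHAR('a) dvd p ^ m" using CHAR_dvd_CARD[where 'a='a] by (simp add: card_ext)
  ultimately show ?thesis
    using prime_p by (metis prime_dvd_power primes_dvd_imp_eq)
qed

lemma prime_CHAR_ext: "prime CHAR('a)"
  using char_ext prime_p by simp

lemma of_int_mod_p: "(of_int (k mod int p) :: 'a) = of_int k"
  using of_int_mod_CHAR[where 'a='a] by (simp add: char_ext)

section \<open>GF(p) as the fixed field of the Frobenius map\<close>

lemma emb_add: "emb (a + b) = emb a + emb b"
  by (simp add: gf_embed_def to_int_mod_ring_add card_base of_int_mod_p)

lemma emb_mult: "emb (a * b) = emb a * emb b"
  by (simp add: gf_embed_def to_int_mod_ring_mult card_base of_int_mod_p)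

lemma emb_0 [simp]: "emb 0 = 0"
  by (simp add: gf_embed_def)

lemma emb_1 [simp]: "emb 1 = 1"
  by (simp add: gf_embed_def)

lemma emb_eq_0_iff [simp]: "emb a = 0 \<longleftrightarrow> a = 0"
proof
  assume "emb a = 0"
  then have "emb (a * inverse a) = 0" by (simp add: emb_mult)
  then show "a = 0" by (cases "a = 0") auto
qed simp

lemma emb_power: "emb (a ^ k) = emb a ^ k"
  by (induction k) (auto simp: emb_mult)

lemma emb_inject: "emb a = emb b \<longleftrightarrow> a = b"
proof
  assume h: "emb a = emb b"
  have "emb a = emb (a - b) + emb b" by (simp flip: emb_add)
  then have "a - b = 0" using h by simp
  then show "a = b" by simp
qed simp

lemma emb_power_p: "emb a ^ p = emb a"
  using finite_field_power_card[of a] by (simp add: card_base flip: emb_power)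

lemma emb_power_p_power: "emb a ^ (p ^ i) = emb a"
  by (induction i) (auto simp: power_mult emb_power_p)

text \<open>\<open>X^p - X\<close> has at most \<open>p\<close> roots, and the injective image of
  GF(p) already supplies \<open>p\<close> of them.\<close>

lemma range_emb:
  assumes "y ^ p = y" shows "\<exists>a. emb a = y"
proof -
  define P where "P = monom (1::'a) p - monom 1 1"
  have "coeff P p = 1" using p_gt_1 by (simp add: P_def)
  then have P0: "P \<noteq> 0" by auto
  have "degree P \<le> p"
    unfolding P_def by (rule degree_diff_le) (use p_gt_1 in \<open>auto simp: degree_monom_eq\<close>)
  with card_poly_roots_bound[OF P0] have le: "card {x. poly P x = 0} \<le> p" by linarith
  have "range emb \<subseteq> {x. poly P x = 0}" by (auto simp: P_def poly_monom emb_power_p)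
  moreover have "card (range emb) = p" by (simp add: card_image inj_def emb_inject card_base)
  ultimately have "range emb = {x. poly P x = 0}" using le by (metis card_seteq finite)
  moreover have "y \<in> {x. poly P x = 0}" using assms by (simp add: P_def poly_monom)
  ultimately show ?thesis by (metis imageE)
qed

section \<open>The trace as a Frobenius-invariant linear functional\<close>

lemma frobenius_add: "(x + y :: 'a) ^ (p ^ i) = x ^ (p ^ i) + y ^ (p ^ i)"
  by (rule freshmans_dream'[OF prime_CHAR_ext]) (simp add: char_ext)

text \<open>Frobenius shifts the summands cyclically: the last one becomes
  \<open>x ^ (p ^ m) = x\<close>.\<close>

lemma trace_sum_power_p:
  fixes x :: 'a
  shows "(\<Sum>i<m. x ^ (p ^ i)) ^ p = (\<Sum>i<m. x ^ (p ^ i))"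
proof -
  have "(\<Sum>i<m. x ^ (p ^ i)) ^ p = (\<Sum>i<m. x ^ (p ^ Suc i))"
    by (subst freshmans_dream_sum[OF prime_CHAR_ext]) (auto simp: char_ext mult.commute simp flip: power_mult)
  also have "\<dots> = (\<Sum>i<m. x ^ (p ^ i))"
    using sum.lessThan_Suc_shift[of "\<lambda>i. x ^ (p ^ i)" m] sum.lessThan_Suc[of "\<lambda>i. x ^ (p ^ i)" m]
      finite_field_power_card[of x] by (simp add: card_ext)
  finally show ?thesis .
qed

text \<open>The description in \<open>gf_trace\<close> is proper: the sum is fixed by Frobenius,
  hence has a preimage, which is unique by injectivity. Identities for \<open>tr\<close> can now be
  checked after embedding.\<close>

lemma emb_tr: "emb (tr x) = (\<Sum>i<m. x ^ (p ^ i))"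
proof -
  obtain a where a: "emb a = (\<Sum>i<m. x ^ (p ^ i))"
    using range_emb[OF trace_sum_power_p] by blast
  have "tr x = a" unfolding gf_trace_def card_base by (rule the_equality) (metis a, metis a emb_inject)
  with a show ?thesis by simp
qed

lemma tr_add: "tr (x + y) = tr x + tr y"
proof -
  have "emb (tr (x + y)) = emb (tr x + tr y)"
    by (simp add: emb_tr frobenius_add sum.distrib emb_add)
  then show ?thesis by (simp only: emb_inject)
qed

lemma tr_emb_mult: "tr (emb a * x) = a * tr x"
proof -
  have "emb (tr (emb a * x)) = emb (a * tr x)"
    by (simp add: emb_tr power_mult_distrib emb_power_p_power sum_distrib_left emb_mult)
  then show ?thesis by (simp only: emb_inject)
qed

lemma tr_0 [simp]: "tr 0 = 0"
  by (metis add_cancel_right_right tr_add)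

lemma tr_minus: "tr (- x) = - tr x"
  by (metis add.right_inverse minus_unique tr_0 tr_add)

lemma tr_diff: "tr (x - y) = tr x - tr y"
  using tr_add[of x "- y"] by (simp add: tr_minus)

lemma tr_power_p: "tr (x ^ p) = tr x"
proof -
  have "emb (tr (x ^ p)) = (\<Sum>i<m. x ^ (p ^ i)) ^ p"
    by (subst freshmans_dream_sum[OF prime_CHAR_ext]) (auto simp: char_ext emb_tr mult.commute simp flip: power_mult)
  then have "emb (tr (x ^ p)) = emb (tr x)" by (simp only: trace_sum_power_p emb_tr)
  then show ?thesis by (simp only: emb_inject)
qed

text \<open>Keeps the set of elements of trace 1 stable under \<open>x ^ (p ^ i)\<close>, as the
  parity argument requires.\<close>

lemma tr_power_p_power: "tr (x ^ (p ^ i)) = tr x"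
  by (induction i arbitrary: x) (auto simp: power_mult tr_power_p)

text \<open>Otherwise the trace polynomial, nonzero of degree at most \<open>p ^ (m - 1)\<close>,
  would vanish at all \<open>p ^ m\<close> elements.\<close>

lemma tr_nonzero: "\<exists>z. tr z \<noteq> 0"
proof (rule ccontr)
  assume "\<not> ?thesis"
  then have z: "(\<Sum>i<m. x ^ (p ^ i)) = 0" for x :: 'a using emb_tr[of x] by simp
  define P where "P = (\<Sum>i<m. monom (1::'a) (p ^ i))"
  have inj: "p ^ i = p ^ j \<longleftrightarrow> i = j" for i j using p_gt_1 by simp
  \<comment> \<open>The exponents \<open>p ^ i\<close> are distinct, so a single monomial
    contributes.\<close>
  have "coeff P (p ^ (m - 1)) = 1"
    using m_pos by (simp add: P_def coeff_sum inj if_distrib cong: if_cong)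
  then have P0: "P \<noteq> 0" by auto
  have "degree P \<le> p ^ (m - 1)"
    unfolding P_def by (rule degree_sum_le) (use p_gt_1 in \<open>auto simp: degree_monom_eq\<close>)
  moreover have "poly P x = 0" for x
    using z[of x] by (simp add: P_def poly_sum poly_monom)
  ultimately have "p ^ m \<le> p ^ (m - 1)"
    using card_poly_roots_bound[OF P0] by (simp add: card_ext)
  then show False using p_gt_1 m_pos by simp
qed

end

section \<open>Counting with the quadratic form\<close>

lemma card_eq_sum_fibres:
  fixes f :: "'x \<Rightarrow> 'y::finite"
  assumes "finite A"
  shows "card A = (\<Sum>t\<in>UNIV. card {x \<in> A. f x = t})"
  using sum.group[OF assms, of UNIV f "\<lambda>_. 1::nat"] by simp

lemma card_pairs_eq_sum:
  fixes P :: "'x::finite \<Rightarrow> 'y::finite \<Rightarrow> bool"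
  shows "card {(x, y). P x y} = (\<Sum>x\<in>UNIV. card {y. P x y})"
proof -
  have "{(x, y). P x y} = Sigma UNIV (\<lambda>x. {y. P x y})" by auto
  then show ?thesis by (simp add: card_SigmaI)
qed

locale gf_even_extension = gf_extension TA TP p m
  for TA :: "'a::{field,finite} itself" and TP :: "'p::prime_card itself" and p m +
  assumes odd_p: "odd p" and even_m: "even m"
begin

section \<open>The quadratic form and its level sets\<close>

abbreviation quad :: "'a \<Rightarrow> 'p mod_ring" where "quad x \<equiv> tr (x ^ 2)"

lemma m_ge_2: "m \<ge> 2"
  using even_m m_pos by (cases "m = 1") auto

lemma two_ne_0_ext: "(2::'a) \<noteq> 0"
proof
  assume "(2::'a) = 0"
  then have "of_nat 2 = (0::'a)" by simp
  then have "p dvd 2" by (simp only: of_nat_eq_0_iff_char_dvd char_ext)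
  then have "p \<le> 2" by (rule dvd_imp_le) simp
  then show False using p_gt_1 odd_p by (cases "p = 2") auto
qed

lemma emb_2: "emb 2 = 2"
  using emb_add[of 1 1] by simp

lemma two_ne_0_base: "(2::'p mod_ring) \<noteq> 0"
  using two_ne_0_ext emb_2 by auto

text \<open>The \<open>p\<close> level sets are translates of each other by multiples of one vector
  \<open>w\<close>, hence equally large.\<close>

lemma card_tr_mult_eq:
  assumes b: "b \<noteq> 0"
  shows "card {x. tr (b * x) = t} = p ^ (m - 1)"
proof -
  obtain z where z: "tr z \<noteq> 0" using tr_nonzero by blast
  \<comment> \<open>Normalised so that \<open>tr (b * w) = 1\<close>.\<close>
  define w where "w = emb (inverse (tr z)) * z / b"
  have w: "tr (b * (emb s * w)) = s" for s
  proof -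
    have "b * (emb s * w) = emb s * (emb (inverse (tr z)) * z)" using b by (simp add: w_def)
    then have "tr (b * (emb s * w)) = s * (inverse (tr z) * tr z)" by (simp only: tr_emb_mult)
    then show ?thesis using z by simp
  qed
  have eq: "card {x. tr (b * x) = s} = card {x. tr (b * x) = 0}" for s
    by (rule bij_betw_same_card[of "\<lambda>x. x - emb s * w"],
        rule bij_betw_byWitness[of _ "\<lambda>x. x + emb s * w"])
      (auto simp: w tr_add tr_diff ring_distribs)
  have "p ^ m = (\<Sum>s\<in>(UNIV::'p mod_ring set). card {x. tr (b * x) = s})"
    using card_eq_sum_fibres[of "UNIV::'a set" "\<lambda>x. tr (b * x)"] by (simp add: card_ext)
  also have "\<dots> = p * card {x. tr (b * x) = 0}"
    by (subst eq) (simp add: card_base)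
  finally have "p * p ^ (m - 1) = p * card {x. tr (b * x) = 0}"
    using m_pos by (simp flip: power_Suc)
  then show ?thesis using p_gt_1 eq[of t] by simp
qed

text \<open>The polar form of \<open>quad\<close> is \<open>2 * tr (b * v)\<close>; this is how the
  hyperplane attached to \<open>b\<close> enters counts along lines.\<close>

lemma quad_line:
  "quad (b + emb l * v) = quad b + 2 * l * tr (b * v) + l ^ 2 * quad v"
proof -
  have "(b + emb l * v) ^ 2 = b ^ 2 + emb (2 * l) * (b * v) + emb (l ^ 2) * v ^ 2"
    by (simp add: emb_mult emb_power emb_2 power2_eq_square algebra_simps)
  then show ?thesis by (simp only: tr_add tr_emb_mult)
qed

text \<open>Multiplication by a square root \<open>c\<close> of \<open>t\<close>, which exists in
  GF(q) because \<open>m\<close> is even, multiplies \<open>quad\<close> by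
  \<open>t\<close>.\<close>

lemma card_quad_eq:
  assumes "t \<noteq> 0"
  shows "card {x. quad x = t} = card {x. quad x = 1}"
proof -
  obtain c where c: "emb t = c ^ 2"
    using fixed_imp_square[OF two_ne_0_ext odd_p, of "m div 2" "emb t"]
    by (auto simp: card_ext even_m emb_power_p)
  then have c0: "c \<noteq> 0" using assms by (metis emb_eq_0_iff zero_power2)
  have scale: "quad (c * x) = t * quad x" for x
    by (simp add: power_mult_distrib tr_emb_mult flip: c)
  have "quad (x / c) = quad x / t" for x
    using scale[of "x / c"] c0 assms by (simp add: field_simps)
  then have "bij_betw (\<lambda>x. c * x) {x. quad x = 1} {x. quad x = t}"
    by (intro bij_betw_byWitness[of _ "\<lambda>x. x / c"]) (use c0 scale assms in auto)
  then show ?thesis by (simp add: bij_betw_same_card)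
qed

text \<open>Used with the identity for \<open>g\<close> to count elements and with squaring to count
  pairs.\<close>

lemma sum_over_quad_values:
  fixes g :: "nat \<Rightarrow> nat"
  shows "(\<Sum>t\<in>UNIV. g (card {x. quad x = t})) = g (card {x. quad x = 0}) + (p - 1) * g (card {x. quad x = 1})"
proof -
  have "(\<Sum>t\<in>UNIV. g (card {x. quad x = t}))
      = g (card {x. quad x = 0}) + (\<Sum>t\<in>UNIV - {0}. g (card {x. quad x = t}))"
    by (rule sum.remove) auto
  also have "(\<Sum>t\<in>UNIV - {0}. g (card {x. quad x = t})) = (\<Sum>t\<in>UNIV - {0::'p mod_ring}. g (card {x. quad x = 1}))"
    by (intro sum.cong arg_cong[of _ _ g] card_quad_eq) auto
  also have "\<dots> = (p - 1) * g (card {x. quad x = 1})"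
    by (simp add: card_base)
  finally show ?thesis .
qed

lemma card_quad_total: "card {x. quad x = 0} + (p - 1) * card {x. quad x = 1} = p ^ m"
  using card_eq_sum_fibres[of "UNIV::'a set" quad] sum_over_quad_values[of "\<lambda>n. n"]
  by (simp add: card_ext)

text \<open>Both sides count the pairs with \<open>quad y = quad x\<close>: on the left by the
  common value, on the right as solutions of \<open>tr (u * v) = 0\<close>, where
  \<open>u = 0\<close> allows every \<open>v\<close> and any other \<open>u\<close> a
  hyperplane.\<close>

lemma card_quad_pairs:
  "(card {x. quad x = 0})\<^sup>2 + (p - 1) * (card {x. quad x = 1})\<^sup>2 = p ^ m + (p ^ m - 1) * p ^ (m - 1)"
proof -
  have "(\<Sum>x\<in>UNIV. card {y. quad y = quad x}) = (\<Sum>t\<in>UNIV. \<Sum>x | quad x = t. card {y. quad y = quad x})"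
    using sum.group[of UNIV UNIV quad "\<lambda>x. card {y. quad y = quad x}"] by simp
  also have "\<dots> = (\<Sum>t\<in>UNIV. (card {x. quad x = t})\<^sup>2)"
    by (rule sum.cong) (auto simp: power2_eq_square)
  also have "\<dots> = (card {x. quad x = 0})\<^sup>2 + (p - 1) * (card {x. quad x = 1})\<^sup>2"
    by (rule sum_over_quad_values)
  finally have 1: "(\<Sum>x\<in>UNIV. card {y. quad y = quad x}) = \<dots>" .
  have halves: "(u + v) / 2 + (u - v) / 2 = u" "(u + v) / 2 - (u - v) / 2 = v" for u v :: 'a
    using two_ne_0_ext by (simp_all flip: add_divide_distrib diff_divide_distrib mult_2)
  have "bij_betw (\<lambda>(x, y). (x + y, x - y)) {(x, y). quad y = quad x} {(u, v). tr (u * v) = 0}"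
  proof (rule bij_betw_byWitness[of _ "\<lambda>(u, v). ((u + v) / 2, (u - v) / 2)"])
    have prod: "(x + y) * (x - y) = x ^ 2 - y ^ 2" for x y :: 'a
      by (simp add: power2_eq_square algebra_simps)
    show "(\<lambda>(x, y). (x + y, x - y)) ` {(x, y). quad y = quad x} \<subseteq> {(u, v). tr (u * v) = 0}"
      by (auto simp: prod tr_diff)
    have "tr (u * v) = quad ((u + v) / 2) - quad ((u - v) / 2)" for u v
      by (simp only: halves flip: tr_diff prod)
    then show "(\<lambda>(u, v). ((u + v) / 2, (u - v) / 2)) ` {(u, v). tr (u * v) = 0} \<subseteq> {(x, y). quad y = quad x}"
      by auto
  qed (use two_ne_0_ext in \<open>auto simp: halves simp flip: mult_2\<close>)
  then have "card {(x, y). quad y = quad x} = card {(u, v). tr (u * v) = 0}"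
    by (rule bij_betw_same_card)
  then have "(\<Sum>x\<in>UNIV. card {y. quad y = quad x}) = (\<Sum>u\<in>UNIV. card {v. tr (u * v) = 0})"
    by (simp only: card_pairs_eq_sum)
  also have "\<dots> = CARD('a) + (\<Sum>u\<in>UNIV - {0}. card {v. tr (u * v) = 0})"
    by (subst sum.remove[of _ 0]) auto
  also have "(\<Sum>u\<in>UNIV - {0}. card {v. tr (u * v) = 0}) = (\<Sum>u\<in>UNIV - {0::'a}. p ^ (m - 1))"
    by (rule sum.cong) (auto simp: card_tr_mult_eq)
  finally show ?thesis using 1 by (simp add: card_ext)
qed

text \<open>The total count expresses the number of zeros through \<open>d\<close>, so the pair
  count becomes an equation in \<open>d\<close> alone.\<close>

lemma quad_deviation_squared:
  "(int (card {x. quad x = 1}) - int p ^ (m - 1))\<^sup>2 = int p ^ (m - 2)"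
proof -
  define a where "a = int p"
  define r where "r = a ^ (m - 2)"
  define d where "d = int (card {x. quad x = 1}) - a ^ (m - 1)"
  \<comment> \<open>Removes the truncated subtractions from the exponents.\<close>
  obtain k where k: "m = k + 2" using m_ge_2 by (metis add.commute le_add_diff_inverse)
  have pw: "a ^ (m - 1) = a * r" "a ^ m = a * a * r" by (simp_all add: r_def k)
  have a: "a > 1" using p_gt_1 by (simp add: a_def)
  have N1: "int (card {x. quad x = 1}) = a * r + d" unfolding d_def pw by simp
  have "int (card {x. quad x = 0}) + (a - 1) * int (card {x. quad x = 1}) = a ^ m"
    using arg_cong[OF card_quad_total, of int] p_gt_1 by (simp add: a_def of_nat_diff)
  then have N0: "int (card {x. quad x = 0}) = a * r - (a - 1) * d"
    unfolding N1 pw by (simp add: algebra_simps)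
  have "p ^ m \<ge> 1" using p_gt_1 by simp
  then have "int (p ^ m + (p ^ m - 1) * p ^ (m - 1)) = a ^ m + (a ^ m - 1) * a ^ (m - 1)"
    by (simp only: a_def of_nat_add of_nat_mult of_nat_power of_nat_diff of_nat_1)
  moreover have "int ((card {x. quad x = 0})\<^sup>2 + (p - 1) * (card {x. quad x = 1})\<^sup>2)
      = (int (card {x. quad x = 0}))\<^sup>2 + (a - 1) * (int (card {x. quad x = 1}))\<^sup>2"
    using p_gt_1 by (simp add: a_def of_nat_diff)
  ultimately have "(a * r - (a - 1) * d)\<^sup>2 + (a - 1) * (a * r + d)\<^sup>2 = a * a * r + (a * a * r - 1) * (a * r)"
    using card_quad_pairs unfolding N0 N1 pw by metis
  \<comment> \<open>The terms linear in \<open>d\<close> cancel.\<close>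
  then have "a * (a - 1) * (d\<^sup>2 - r) = 0" by (simp add: power2_eq_square algebra_simps)
  then have "d\<^sup>2 = r" using a by simp
  then show ?thesis by (simp add: d_def r_def a_def)
qed

section \<open>The sign of the deviation modulo 4\<close>

lemma odd_card_trace_one_squares: "odd (card {y. (\<exists>c. y = c\<^sup>2) \<and> tr y = 1})"
proof -
  obtain r where "m = 2 ^ multiplicity 2 m * r" "odd r"
    using m_pos by (rule_tac multiplicity_decompose'[of m 2]) auto
  then obtain a where ar: "m = 2 ^ a * r" "odd r" by blast
  \<comment> \<open>As \<open>a > 0\<close>, the field has \<open>(p ^ r) ^ (2 * 2 ^ a')\<close>
    elements, the form in which \<open>fixed_imp_square\<close> applies to
    \<open>P = p ^ r\<close>.\<close>
  then obtain a' where a': "a = Suc a'" using even_m by (cases a) auto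
  define f where "f = (\<lambda>x::'a. x ^ (p ^ r))"
  have iter: "(f ^^ k) x = x ^ (p ^ (r * k))" for k x
    by (induction k) (simp_all add: f_def power_add mult.commute flip: power_mult)
  have id: "(f ^^ (2 ^ a)) x = x" for x
    using finite_field_power_card[of x] by (simp add: iter card_ext ar mult.commute)
  have trf: "tr (f x) = tr x" for x by (simp add: f_def tr_power_p_power)
  \<comment> \<open>The factor 1 makes \<open>?T\<close> an instance of
    \<open>card_tr_mult_eq\<close>.\<close>
  let ?Y = "{y. (\<exists>c. y = c\<^sup>2) \<and> tr y = 1}" and ?T = "{y. tr (1 * y) = 1}"
  have "even (card ?Y) \<longleftrightarrow> even (card {y \<in> ?Y. f y = y})"
  proof (rule parity_card_fixed_points)
    fix y assume "y \<in> ?Y"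
    moreover have "f (c\<^sup>2) = (f c)\<^sup>2" for c by (simp add: f_def mult.commute flip: power_mult)
    ultimately show "f y \<in> ?Y" by (auto simp: trf)
  qed (auto intro: id)
  moreover have "even (card ?T) \<longleftrightarrow> even (card {y \<in> ?T. f y = y})"
    by (rule parity_card_fixed_points) (auto simp: trf intro: id)
  moreover have "{y \<in> ?Y. f y = y} = {y \<in> ?T. f y = y}"
  proof -
    have "\<exists>c. y = c\<^sup>2" if "f y = y" for y
      by (rule fixed_imp_square[OF two_ne_0_ext, of "p ^ r" "2 ^ a'"])
        (use that odd_p in \<open>auto simp: f_def card_ext ar a' mult_ac simp flip: power_mult\<close>)
    then show ?thesis by auto
  qed
  moreover have "odd (card ?T)"
    using odd_p by (simp only: card_tr_mult_eq[OF one_neq_zero] even_power) simp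
  ultimately show ?thesis by simp
qed

lemma card_quad_one:
  assumes \<epsilon>: "\<epsilon> = (-1) ^ (((p - 1) div 2) ^ 2 * (m div 2))"
  shows "int (card {x. quad x = 1}) = int p ^ (m - 1) + \<epsilon> * int p ^ ((m - 2) div 2)"
proof -
  define N where "N = int (card {x. quad x = 1})"
  have "card {x. quad x = 1} = 2 * card ((\<lambda>x. x\<^sup>2) ` {x. quad x = 1})"
    by (rule card_eq_twice_card_squares[OF two_ne_0_ext]) auto
  moreover have "(\<lambda>x. x\<^sup>2) ` {x. quad x = 1} = {y. (\<exists>c. y = c\<^sup>2) \<and> tr y = 1}" by auto
  ultimately have "N = 2 * int (card {y. (\<exists>c. y = c\<^sup>2) \<and> tr y = 1})"
    by (simp add: N_def)
  moreover have "odd (int (card {y. (\<exists>c. y = c\<^sup>2) \<and> tr y = 1}))"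
    using odd_card_trace_one_squares by simp
  ultimately have N4: "N mod 4 = 2" by presburger
  obtain j where j: "m = 2 * j + 2"
    using m_ge_2 even_m by (metis add.commute dvd_diff_nat dvd_refl evenE le_add_diff_inverse)
  have "(N - int p ^ (m - 1))\<^sup>2 = (int p ^ j)\<^sup>2"
    using quad_deviation_squared by (simp add: N_def j power_mult mult.commute power_even_eq)
  then obtain s where s: "N = int p ^ (m - 1) + s * int p ^ j" "s = 1 \<or> s = -1"
    unfolding power2_eq_iff by (metis add.commute diff_add_cancel mult_1 mult_minus1)
  have p4: "int p mod 4 = 1 \<or> int p mod 4 = 3" using odd_p by presburger
  \<comment> \<open>Odd squares are 1 modulo 4, so only the parity of the exponent matters.\<close>
  have pow4: "int p ^ k mod 4 = (if even k then 1 else int p mod 4)" for k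
  proof (induction k)
    case (Suc k)
    have "int p ^ Suc k mod 4 = ((int p mod 4) * (int p ^ k mod 4)) mod 4"
      by (simp add: mod_mult_eq)
    then show ?case using Suc p4 by auto
  qed simp
  have "s = \<epsilon>"
  proof -
    have "(int p ^ (m - 1) mod 4 + s * (int p ^ j mod 4)) mod 4 = N mod 4"
      unfolding s(1) by (simp only: mod_add_left_eq mod_add_right_eq mod_mult_right_eq)
        (metis mod_add_right_eq mod_mult_right_eq)
    \<comment> \<open>The exponent \<open>m - 1 = 2 * j + 1\<close> is odd. The congruence forces
      \<open>s = 1\<close> if \<open>p\<close> is 1 modulo 4, and \<open>s = (-1) ^ (j + 1)\<close>
      if \<open>p\<close> is 3 modulo 4.\<close>
    then have n: "(int p mod 4 + s * (int p ^ j mod 4)) mod 4 = 2"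
      using N4 pow4[of "m - 1"] j by simp
    from p4 show ?thesis
    proof
      assume h: "int p mod 4 = 1"
      then have "even ((p - 1) div 2)" by presburger
      then have "\<epsilon> = 1" using \<epsilon> by simp
      then show ?thesis using n s(2) h by (auto simp: pow4 split: if_splits)
    next
      assume h: "int p mod 4 = 3"
      then have "odd ((p - 1) div 2)" by presburger
      \<comment> \<open>Here \<open>m div 2 = j + 1\<close>, and the square of an odd number is
        odd.\<close>
      then have "\<epsilon> = (if odd j then 1 else -1)" using \<epsilon> j by (simp add: minus_one_power_iff)
      then show ?thesis using n s(2) h by (auto simp: pow4 split: if_splits)
    qed
  qed
  then show ?thesis using s(1) j by (simp add: N_def)
qed

text \<open>Equates the two counts of the pairs \<open>(l, v)\<close> and eliminates the union of
  \<open>?A\<close> and \<open>?B\<close> by inclusion-exclusion. Terms are moved across the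
  equation to avoid differences of cardinalities.\<close>

lemma card_quad_hyperplane:
  assumes b: "b \<noteq> 0"
  shows "(p - 1) * card {x. quad x = quad b} + card {x. quad x = 0} + p ^ (m - 1)
    = p * card {x. quad x = 0 \<and> tr (b * x) = 0} + p ^ m"
proof -
  let ?L = "UNIV - {0::'p mod_ring}"
  let ?A = "{x. quad x = 0}" and ?B = "{x. tr (b * x) = 0}"
  have "card {(l, v). l \<in> ?L \<and> quad (b + emb l * v) = quad b} = (p - 1) * card {x. quad x = quad b}"
  proof -
    have "card {v. quad (b + emb l * v) = quad b} = card {x. quad x = quad b}" if "l \<noteq> 0" for l
    proof (rule bij_betw_same_card[of "\<lambda>v. b + emb l * v"])
      show "bij_betw (\<lambda>v. b + emb l * v) {v. quad (b + emb l * v) = quad b} {x. quad x = quad b}"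
        by (rule bij_betw_byWitness[of _ "\<lambda>x. (x - b) / emb l"]) (use that in auto)
    qed
    then have "(\<Sum>l\<in>?L. card {v. quad (b + emb l * v) = quad b}) = (p - 1) * card {x. quad x = quad b}"
      by (simp add: card_base)
    moreover have "{(l, v). l \<in> ?L \<and> quad (b + emb l * v) = quad b}
        = Sigma ?L (\<lambda>l. {v. quad (b + emb l * v) = quad b})" by auto
    ultimately show ?thesis by (simp add: card_SigmaI)
  qed
  moreover have "card {(l, v). l \<in> ?L \<and> quad (b + emb l * v) = quad b}
      = (p - 1) * card (?A \<inter> ?B) + card (- (?A \<union> ?B))"
  proof -
    \<comment> \<open>On the line the difference to \<open>quad b\<close> has a factor
      \<open>l\<close>; cancelling it leaves an equation linear in \<open>l\<close>.\<close>
    have eqv: "l \<noteq> 0 \<and> quad (b + emb l * v) = quad b \<longleftrightarrow> l \<noteq> 0 \<and> l * quad v = - 2 * tr (b * v)" for l v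
    proof -
      have "quad (b + emb l * v) - quad b = l * (l * quad v - (- 2 * tr (b * v)))"
        unfolding quad_line by (simp add: algebra_simps power2_eq_square[of l])
      then show ?thesis by (metis eq_iff_diff_eq_0 mult_eq_0_iff)
    qed
    have sum_if: "(\<Sum>v\<in>UNIV. if v \<in> X then k else 0) = k * card X" for X :: "'a set" and k :: nat
      by (simp add: sum.If_cases)
    \<comment> \<open>If both coefficients vanish, every nonzero \<open>l\<close> is a solution; if
      exactly one vanishes, none is; otherwise the solution is unique and nonzero.\<close>
    have fib: "card {l. l \<noteq> 0 \<and> l * quad v = - 2 * tr (b * v)}
        = (if v \<in> ?A \<inter> ?B then p - 1 else 0) + (if v \<in> - (?A \<union> ?B) then 1 else 0)" for v
    proof (cases "quad v = 0")
      case True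
      have "{l::'p mod_ring. l \<noteq> 0} = ?L" by auto
      then show ?thesis using True two_ne_0_base by (auto simp: card_base)
    next
      case False
      then have "{l. l \<noteq> 0 \<and> l * quad v = - 2 * tr (b * v)} = (if tr (b * v) = 0 then {} else {- 2 * tr (b * v) / quad v})"
        using two_ne_0_base by (auto simp: field_simps)
      then show ?thesis using False by simp
    qed
    have "card {(l, v). l \<in> ?L \<and> quad (b + emb l * v) = quad b}
        = card {(v, l). l \<noteq> 0 \<and> l * quad v = - 2 * tr (b * v)}"
      by (rule bij_betw_same_card[of prod.swap], rule bij_betw_byWitness[of _ prod.swap]) (auto simp: eqv[simplified])
    also have "\<dots> = (\<Sum>v\<in>UNIV. card {l. l \<noteq> 0 \<and> l * quad v = - 2 * tr (b * v)})"
      by (rule card_pairs_eq_sum)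
    also have "\<dots> = (p - 1) * card (?A \<inter> ?B) + card (- (?A \<union> ?B))"
      unfolding fib sum.distrib sum_if by simp
    finally show ?thesis .
  qed
  moreover have "card (- (?A \<union> ?B)) + card (?A \<union> ?B) = p ^ m"
  proof -
    have "card (- X) + card X = p ^ m" for X :: "'a set"
      using card_Un_disjoint[of "- X" X] by (simp add: card_ext Compl_partition2)
    then show ?thesis .
  qed
  moreover have "card (?A \<union> ?B) + card (?A \<inter> ?B) = card ?A + p ^ (m - 1)"
    using card_Un_Int[of ?A ?B] card_tr_mult_eq[OF b, of 0] by simp
  moreover have "p * card (?A \<inter> ?B) = (p - 1) * card (?A \<inter> ?B) + card (?A \<inter> ?B)"
    using p_gt_1 by (cases p) auto
  moreover have "?A \<inter> ?B = {x. quad x = 0 \<and> tr (b * x) = 0}" by auto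
  ultimately show ?thesis by simp
qed

end

section \<open>The trace code\<close>

text \<open>Vectors correspond to coefficient functions on a basis \<open>B\<close>, taken
  extensional so that each vector has exactly one.\<close>

lemma (in vectorspace) card_eq_power_dim:
  assumes "finite (carrier V)"
  shows "card (carrier V) = card (carrier K) ^ dim"
proof -
  have "fin_dim"
    unfolding fin_dim_def
    by (rule exI[of _ "carrier V"]) (use assms in_own_span[of "carrier V"] span_is_subset2[of "carrier V"] in auto)
  then obtain B where B: "finite B" "basis B" using finite_basis_exists by blast
  then have BV: "B \<subseteq> carrier V" by (simp add: basis_def)
  have ex: "\<exists>!a. a \<in> B \<rightarrow>\<^sub>E carrier K \<and> lincomb a B = v" if "v \<in> carrier V" for v
    using that basis_criterion[OF B(1) BV] B(2) by blast
  have closed: "lincomb a B \<in> carrier V" if "a \<in> B \<rightarrow>\<^sub>E carrier K" for a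
    using that BV by (intro lincomb_closed) (auto simp: PiE_iff)
  have "bij_betw (\<lambda>a. lincomb a B) (B \<rightarrow>\<^sub>E carrier K) (carrier V)"
    unfolding bij_betw_def
  proof
    show "inj_on (\<lambda>a. lincomb a B) (B \<rightarrow>\<^sub>E carrier K)"
      using ex closed by (intro inj_onI) metis
    show "(\<lambda>a. lincomb a B) ` (B \<rightarrow>\<^sub>E carrier K) = carrier V"
      using ex closed by blast
  qed
  then have "card (carrier V) = card (B \<rightarrow>\<^sub>E carrier K)" by (simp add: bij_betw_same_card)
  then show ?thesis using B by (simp add: card_PiE dim_basis)
qed

text \<open>Over a finite field the cardinality determines the dimension, so no basis of the code
  has to be exhibited.\<close>

lemma code_dim_eqI:
  fixes C :: "'k::{field,finite} vec set"
  assumes "linear_code n C" and "card C = CARD('k) ^ d"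
  shows "code_dim n C = d"
proof -
  let ?W = "(module_vec TYPE('k) n)\<lparr>carrier := C\<rparr>"
  interpret V: vectorspace "class_ring :: 'k ring" "module_vec TYPE('k) n" by (rule vec_vs)
  interpret W: vectorspace "class_ring :: 'k ring" ?W
    using V.subspace_is_vs assms(1) by (simp add: linear_code_def)
  have "CARD('k) > 1"
    using card_mono[of "UNIV::'k set" "{0,1}"] by simp
  \<comment> \<open>An infinite set would have \<open>card\<close> equal to 0, which is no power of
    \<open>CARD('k)\<close>.\<close>
  then have "finite C" using assms(2) by (metis card.infinite not_one_less_zero power_eq_0_iff)
  then have "card C = CARD('k) ^ W.dim" using W.card_eq_power_dim by (simp add: class_ring_simps)
  then show ?thesis using assms(2) \<open>CARD('k) > 1\<close> by (simp add: code_dim_def)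
qed

text \<open>Distinctness matches positions with entries, so the weight is independent of the order
  of \<open>ds\<close>.\<close>

lemma hamming_weight_vec_of_list_map:
  assumes "distinct ds"
  shows "hamming_weight (vec_of_list (map f ds)) = card {d \<in> set ds. f d \<noteq> 0}"
proof -
  have "bij_betw ((!) ds) {i. i < length ds \<and> f (ds ! i) \<noteq> 0} {d \<in> set ds. f d \<noteq> 0}"
    using assms by (auto simp: bij_betw_def inj_on_def nth_eq_iff_index_eq in_set_conv_nth)
  then have "card {i. i < length ds \<and> f (ds ! i) \<noteq> 0} = card {d \<in> set ds. f d \<noteq> 0}"
    by (rule bij_betw_same_card)
  moreover have "{i. i < dim_vec (vec_of_list (map f ds)) \<and> vec_of_list (map f ds) $ i \<noteq> 0}
      = {i. i < length ds \<and> f (ds ! i) \<noteq> 0}"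
    by (auto simp: vec_of_list_index)
  ultimately show ?thesis by (simp add: hamming_weight_def)
qed

section \<open>Linearity and injectivity of the codeword map\<close>

context gf_extension
begin

abbreviation codeword :: "'a list \<Rightarrow> 'a \<Rightarrow> 'p mod_ring vec" where
  "codeword ds x \<equiv> vec_of_list (map (\<lambda>d. tr (x * d)) ds)"

lemma codeword_add: "codeword ds (x + y) = codeword ds x + codeword ds y"
  by (rule eq_vecI) (auto simp: vec_of_list_index tr_add ring_distribs)

lemma codeword_diff: "codeword ds (x - y) = codeword ds x - codeword ds y"
  by (rule eq_vecI) (auto simp: vec_of_list_index tr_diff ring_distribs)

lemma codeword_smult: "codeword ds (emb a * x) = a \<cdot>\<^sub>v codeword ds x"
  by (rule eq_vecI) (auto simp: vec_of_list_index mult.assoc tr_emb_mult)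

lemma codeword_0: "codeword ds 0 = 0\<^sub>v (length ds)"
  by (rule eq_vecI) (auto simp: vec_of_list_index)

text \<open>The code is the image of a GF(p)-linear map, with scalars acting on GF(q) through
  \<open>emb\<close>.\<close>

lemma linear_trace_code:
  fixes ds :: "'a list"
  shows "linear_code (length ds) (trace_code m ds :: 'p mod_ring vec set)"
proof -
  let ?V = "module_vec TYPE('p mod_ring) (length ds)"
  have C: "trace_code m ds = range (codeword ds)" by (simp add: trace_code_def)
  have "submodule class_ring (range (codeword ds)) ?V"
  proof (rule submodule.intro)
    show "module class_ring ?V" by (rule vec_module)
    show "range (codeword ds) \<subseteq> carrier ?V"
      by (auto simp: module_vec_simps intro: carrier_vecI)
    show "\<zero>\<^bsub>?V\<^esub> \<in> range (codeword ds)"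
      unfolding module_vec_simps by (metis codeword_0 rangeI)
  next
    fix v w assume "v \<in> range (codeword ds)" "w \<in> range (codeword ds)"
    then obtain x y where "v = codeword ds x" "w = codeword ds y" by blast
    then have "v \<oplus>\<^bsub>?V\<^esub> w = codeword ds (x + y)"
      by (simp only: module_vec_simps codeword_add)
    then show "v \<oplus>\<^bsub>?V\<^esub> w \<in> range (codeword ds)" by blast
  next
    fix c and v assume "v \<in> range (codeword ds)"
    then obtain x where "v = codeword ds x" by blast
    then have "c \<odot>\<^bsub>?V\<^esub> v = codeword ds (emb c * x)"
      by (simp only: module_vec_simps codeword_smult)
    then show "c \<odot>\<^bsub>?V\<^esub> v \<in> range (codeword ds)" by blast
  qed
  then show ?thesis
    unfolding linear_code_def C VectorSpace.subspace_def by (simp add: vec_vs)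
qed

text \<open>By additivity it suffices that the kernel is trivial, and the zero word has weight
  0.\<close>

lemma inj_codeword:
  assumes "distinct ds" and "\<And>x. x \<noteq> 0 \<Longrightarrow> hamming_weight (codeword ds x) \<noteq> 0"
  shows "inj (codeword ds)"
proof (rule injI)
  fix x y assume "codeword ds x = codeword ds y"
  then have "codeword ds (x - y) = codeword ds 0"
    unfolding codeword_diff codeword_0 by (auto intro: eq_vecI)
  then have "hamming_weight (codeword ds (x - y)) = hamming_weight (codeword ds 0)" by simp
  also have "\<dots> = 0" unfolding hamming_weight_vec_of_list_map[OF assms(1)] by simp
  finally show "x = y" using assms(2)[of "x - y"] by auto
qed

text \<open>Turns counting codewords into counting field elements.\<close>

lemma weight_count_trace_code:
  assumes "inj (codeword ds)"
  shows "weight_count (trace_code m ds :: 'p mod_ring vec set) w = card {x. hamming_weight (codeword ds x) = w}"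
proof -
  have "{c \<in> trace_code m ds. hamming_weight c = w} = codeword ds ` {x. hamming_weight (codeword ds x) = w}"
    by (auto simp: trace_code_def)
  then show ?thesis
    using card_image[OF inj_on_subset[OF assms]] by (simp add: weight_count_def)
qed

end

section \<open>The weights of the codewords\<close>

context gf_even_extension
begin

lemma card_quad_zero:
  assumes "\<epsilon> = (-1) ^ (((p - 1) div 2) ^ 2 * (m div 2))"
  shows "int (card {x. quad x = 0}) = int p ^ (m - 1) - \<epsilon> * (int p - 1) * int p ^ ((m - 2) div 2)"
proof -
  have "int (card {x. quad x = 0}) + (int p - 1) * int (card {x. quad x = 1}) = int p ^ m"
    using arg_cong[OF card_quad_total, of int] p_gt_1 by (simp add: of_nat_diff)
  moreover have "int p ^ m = int p * int p ^ (m - 1)" using m_pos by (simp flip: power_Suc)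
  ultimately show ?thesis unfolding card_quad_one[OF assms] by (simp add: algebra_simps)
qed

lemma hamming_weight_codeword:
  assumes \<epsilon>: "\<epsilon> = (-1) ^ (((p - 1) div 2) ^ 2 * (m div 2))"
    and "distinct ds" and ds: "set ds = {x. x \<noteq> 0 \<and> quad x = 0}" and b: "b \<noteq> 0"
  shows "int (hamming_weight (codeword ds b)) =
    (if quad b = 0 then (int p - 1) * int p ^ (m - 2)
     else (int p - 1) * (int p ^ (m - 2) - \<epsilon> * int p ^ ((m - 2) div 2)))"
proof -
  define a where "a = int p"
  define r where "r = a ^ (m - 2)"
  define e where "e = \<epsilon> * a ^ ((m - 2) div 2)"
  obtain k where k: "m = k + 2" using m_ge_2 by (metis add.commute le_add_diff_inverse)
  have pw: "a ^ (m - 1) = a * r" "a ^ m = a * a * r" by (simp_all add: r_def k)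
  have a: "a > 1" using p_gt_1 by (simp add: a_def)
  let ?Z = "{x. quad x = 0 \<and> tr (b * x) = 0}"
  define wt where "wt = int (hamming_weight (codeword ds b))"
  define N0 where "N0 = int (card {x. quad x = 0})"
  define N1 where "N1 = int (card {x. quad x = 1})"
  define Nb where "Nb = int (card {x. quad x = quad b})"
  have N: "N1 = a * r + e" "N0 = a * r - (a - 1) * e"
    using card_quad_one[OF \<epsilon>] card_quad_zero[OF \<epsilon>]
    unfolding N1_def N0_def a_def[symmetric] pw by (simp_all add: e_def mult_ac)
  \<comment> \<open>The element 0 lies in \<open>?Z\<close>, so its absence from \<open>ds\<close>
    does not affect the weight.\<close>
  have "{x. quad x = 0} = ?Z \<union> {d \<in> set ds. tr (b * d) \<noteq> 0}" by (auto simp: ds)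
  then have "card {x. quad x = 0} = card ?Z + card {d \<in> set ds. tr (b * d) \<noteq> 0}"
    by (simp only:) (rule card_Un_disjoint, auto)
  then have Z: "int (card ?Z) = N0 - wt"
    unfolding wt_def N0_def hamming_weight_vec_of_list_map[OF \<open>distinct ds\<close>] by simp
  have "int ((p - 1) * card {x. quad x = quad b} + card {x. quad x = 0} + p ^ (m - 1))
      = (a - 1) * Nb + N0 + a ^ (m - 1)"
    using p_gt_1 by (simp add: a_def Nb_def N0_def of_nat_diff)
  moreover have "int (p * card ?Z + p ^ m) = a * int (card ?Z) + a ^ m" by (simp add: a_def)
  ultimately have E: "(a - 1) * Nb + N0 + a * r = a * (N0 - wt) + a * a * r"
    using card_quad_hyperplane[OF b] unfolding pw Z by metis
  have "a * wt = a * (if quad b = 0 then (a - 1) * r else (a - 1) * (r - e))"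
  proof (cases "quad b = 0")
    case True
    then have "Nb = N0" by (simp add: Nb_def N0_def)
    from E[unfolded this] have "a * wt = a * ((a - 1) * r)"
      by (simp only: ring_distribs mult_ac mult_1_left mult_1_right)
    with True show ?thesis by simp
  next
    case False
    \<comment> \<open>Now \<open>N0 - N1 = - a * e\<close>, the source of the correction to the
      weight.\<close>
    then have "Nb = N1" using card_quad_eq[OF False] by (simp add: Nb_def N1_def)
    from E[unfolded this N] have "a * wt = a * ((a - 1) * (r - e))"
      by (simp only: ring_distribs mult_ac mult_1_left mult_1_right)
    with False show ?thesis by simp
  qed
  then have "wt = (if quad b = 0 then (a - 1) * r else (a - 1) * (r - e))" using a by simp
  then show ?thesis by (simp add: wt_def a_def r_def e_def)
qed

end

(* For m = 2 and p mod 4 = 1 (and only then) D is empty, the code is the zero space of length 0,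
   and the second weight formula evaluates to 0; the claims on the dimension and on that weight
   are false there. They are guarded by n > 0, all others are unconditional. *)
theorem theorem2:
  fixes p m n :: nat and \<epsilon> :: int
    and ds :: "'a::{field,finite} list"
    and C :: "'p::prime_card mod_ring vec set"
  assumes "prime p" and "odd p"
    and "m \<ge> 2" and "even m"
    and "CARD('p) = p" and "CARD('a) = p ^ m"
    and "distinct ds"
    and "set ds = {x. x \<noteq> 0 \<and> (gf_trace m (x ^ 2) :: 'p mod_ring) = 0}"
    and "n = length ds"
    and "C = trace_code m ds"
    and "\<epsilon> = (-1) ^ (((p - 1) div 2) ^ 2 * (m div 2))"
  shows "int n = int p ^ (m - 1) - \<epsilon> * (int p - 1) * int p ^ ((m - 2) div 2) - 1
    \<and> linear_code n C
    \<and> (n > 0 \<longrightarrow> code_dim n C = m)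
    \<and> weight_count C 0 = 1
    \<and> (\<forall>w. int w = (int p - 1) * int p ^ (m - 2) \<longrightarrow>
          int (weight_count C w) =
            int p ^ (m - 1) - \<epsilon> * (int p - 1) * int p ^ ((m - 2) div 2) - 1)
    \<and> (n > 0 \<longrightarrow> (\<forall>w. int w = (int p - 1) * (int p ^ (m - 2) - \<epsilon> * int p ^ ((m - 2) div 2)) \<longrightarrow>
          int (weight_count C w) = (int p - 1) * (int p ^ (m - 1) + \<epsilon> * int p ^ ((m - 2) div 2))))
    \<and> (\<forall>w. int w \<notin> {0, (int p - 1) * int p ^ (m - 2),
                     (int p - 1) * (int p ^ (m - 2) - \<epsilon> * int p ^ ((m - 2) div 2))} \<longrightarrow>
          weight_count C w = 0)"
proof -
  interpret gf_even_extension "TYPE('a)" "TYPE('p)" p m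
    by unfold_locales (use assms in auto)
  note ds = assms(8) and \<epsilon> = assms(11)
  define w\<^sub>1 where "w\<^sub>1 = (int p - 1) * int p ^ (m - 2)"
  define w\<^sub>2 where "w\<^sub>2 = (int p - 1) * (int p ^ (m - 2) - \<epsilon> * int p ^ ((m - 2) div 2))"
  \<comment> \<open>The zero of the field accounts for the final \<open>- 1\<close> in the
    length.\<close>
  have "{x. quad x = 0} = insert 0 (set ds)" by (auto simp: ds)
  then have "card {x. quad x = 0} = Suc n"
    using assms(7,9) ds by (simp only:) (subst card_insert_disjoint, auto simp flip: distinct_card)
  then have n: "int n = int p ^ (m - 1) - \<epsilon> * (int p - 1) * int p ^ ((m - 2) div 2) - 1"
    using card_quad_zero[OF \<epsilon>] by linarith
  have lin: "linear_code n C" using linear_trace_code by (simp add: assms(9,10))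
  have w1_pos: "w\<^sub>1 > 0" using p_gt_1 by (simp add: w\<^sub>1_def)
  show ?thesis
  proof (cases "n = 0")
    case True
    then have "C = {vec_of_list []}" by (auto simp: assms(9,10) trace_code_def)
    then have wc: "weight_count C w = (if w = 0 then 1 else 0)" for w :: nat
    proof -
      have "{c \<in> C. hamming_weight c = w} = (if w = 0 then C else {})"
        using \<open>C = {vec_of_list []}\<close> by (auto simp: hamming_weight_def)
      then show ?thesis using \<open>C = {vec_of_list []}\<close> by (simp add: weight_count_def)
    qed
    \<comment> \<open>Both sides are 0, because \<open>w\<^sub>1\<close> is positive and
      \<open>n = 0\<close>.\<close>
    have "int (weight_count C w) = int n" if "int w = w\<^sub>1" for w
      using that w1_pos wc True by simp
    then show ?thesis using n lin wc True by (simp flip: w\<^sub>1_def)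
  next
    case False
    define wt where "wt x = int (hamming_weight (codeword ds x))" for x
    have "wt 0 = 0" unfolding wt_def hamming_weight_vec_of_list_map[OF assms(7)] by simp
    moreover have "wt b = (if quad b = 0 then w\<^sub>1 else w\<^sub>2)" if "b \<noteq> 0" for b
      using hamming_weight_codeword[OF \<epsilon> assms(7) ds that] by (simp only: wt_def w\<^sub>1_def w\<^sub>2_def)
    ultimately have wt: "wt x = (if x = 0 then 0 else if quad x = 0 then w\<^sub>1 else w\<^sub>2)" for x
      by simp
    define e where "e = \<epsilon> * int p ^ ((m - 2) div 2)"
    have e2: "e\<^sup>2 = int p ^ (m - 2)"
    proof -
      have "\<epsilon>\<^sup>2 = 1" unfolding \<epsilon> by (simp flip: power_mult)
      then show ?thesis using even_m m_ge_2
        by (simp add: e_def power_mult_distrib flip: power_mult)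
    qed
    then have e0: "e \<noteq> 0" using p_gt_1 by auto
    \<comment> \<open>If \<open>w\<^sub>2\<close> vanished, then
      \<open>e = p ^ (m - 2) = e\<^sup>2\<close>, so \<open>e = 1\<close> and \<open>m = 2\<close>,
      and the length would be \<open>p - (p - 1) - 1 = 0\<close>.\<close>
    have w2_ne_0: "w\<^sub>2 \<noteq> 0"
    proof
      assume "w\<^sub>2 = 0"
      then have "int p ^ (m - 2) = e" using p_gt_1 by (simp add: w\<^sub>2_def e_def)
      then have e1: "e = 1" using e2 e0 by (simp add: power2_eq_square)
      then have "int p ^ (m - 2) = 1" using e2 by simp
      then have "m = 2"
        using one_less_power[of "int p" "m - 2"] p_gt_1 m_ge_2 by (cases "m = 2") auto
      then have "int n = 0" using n e1 by (simp add: e_def)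
      then show False using False by simp
    qed
    have w12: "w\<^sub>1 \<noteq> w\<^sub>2" using e0 p_gt_1 by (simp add: w\<^sub>1_def w\<^sub>2_def e_def)
    have "hamming_weight (codeword ds x) \<noteq> 0" if "x \<noteq> 0" for x
    proof -
      have "wt x \<noteq> 0" using that w1_pos w2_ne_0 by (simp add: wt)
      then show ?thesis unfolding wt_def by linarith
    qed
    with assms(7) have inj: "inj (codeword ds)" by (rule inj_codeword)
    have wc: "weight_count C w = card {x. wt x = int w}" for w
      unfolding assms(10) weight_count_trace_code[OF inj] wt_def by (simp only: of_nat_eq_iff)
    have "card C = CARD('p mod_ring) ^ m"
      using inj by (simp add: assms(10) trace_code_def card_image card_ext card_base)
    then have dim: "code_dim n C = m" by (rule code_dim_eqI[OF lin])
    have "{x. wt x = 0} = {0}" using w1_pos w2_ne_0 by (auto simp: wt)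
    then have A0: "weight_count C 0 = 1" by (simp add: wc)
    have "{x. wt x = w\<^sub>1} = set ds" using w1_pos w12 by (auto simp: wt ds)
    then have A1: "weight_count C w = n" if "int w = w\<^sub>1" for w
      using that assms(7,9) by (simp add: wc distinct_card)
    \<comment> \<open>As 0, \<open>w\<^sub>1\<close> and \<open>w\<^sub>2\<close> are pairwise
      distinct, weight \<open>w\<^sub>2\<close> singles out the nonzeros of
      \<open>quad\<close>.\<close>
    have E2: "{x. wt x = w\<^sub>2} = - {x. quad x = 0}"
      using w2_ne_0 w12 by (auto simp: wt)
    have A2: "int (weight_count C w) = (int p - 1) * (int p ^ (m - 1) + \<epsilon> * int p ^ ((m - 2) div 2))"
      if "int w = w\<^sub>2" for w
    proof -
      have "card (- {x. quad x = 0}) + card {x. quad x = 0} = p ^ m"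
        using card_Un_disjoint[of "- {x. quad x = 0}" "{x. quad x = 0}"] by (simp add: card_ext Compl_partition2)
      then have "weight_count C w = (p - 1) * card {x. quad x = 1}"
        using card_quad_total that E2 by (simp only: wc)
      then show ?thesis using card_quad_one[OF \<epsilon>] p_gt_1 by (simp add: of_nat_diff)
    qed
    have "weight_count C w = 0" if "int w \<notin> {0, w\<^sub>1, w\<^sub>2}" for w
    proof -
      have "{x. wt x = int w} = {}" using that by (auto simp: wt)
      then show ?thesis by (simp add: wc)
    qed
    with n lin dim A0 A1 A2 show ?thesis
      unfolding w\<^sub>1_def w\<^sub>2_def by simp
  qed
qed

end
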